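(* Let $d,m\in\mathbb{N}$ and $\boldsymbol{p}=(p_1,\dots,p_d)\in\mathcal{S}_d^o$ be given, and for each $N\in\mathbb{N}$ let $\boldsymbol{\xi}=(\xi_1,\dots,\xi_d)\sim\mathrm{Multinomial}(N,\boldsymbol{p})$ (the dependence of $\boldsymbol{\xi}$ on $N$ is suppressed from the notation). The inequality \[ \lim_{N\to\infty}\left[\mathsf{E}\left\{\prod_{i=1}^d\left(\frac{\xi_i-Np_i}{\sqrt{N}}\right)^{2m}\right\}-\prod_{i=1}^d\mathsf{E}\left\{\left(\frac{\xi_i-Np_i}{\sqrt{N}}\right)^{2m}\right\}\right]\geq 0 \] is equivalent to \[ \sum_{\ell_1,\dots,\ell_d=0}^{2m}\ \sum_{k_1=0}^{\ell_1}\cdots\sum_{k_d=0}^{\ell_d}\left\{\genfrac{[}{]}{0pt}{}{\sum_{i=1}^d k_i}{\sum_{i=1}^d\ell_i-md}^{\star}-\prod_{i=1}^d\genfrac{[}{]}{0pt}{}{k_i}{\ell_i-m}^{\star}\right\}\prod_{i=1}^d\left[\genfrac{\{}{\}}{0pt}{}{\ell_i}{k_i}\binom{2m}{\ell_i}(-1)^{\ell_i}p_i^{2m-\ell_i+k_i}\right]\geq 0, \] where $\genfrac{[}{]}{0pt}{}{k}{j}^{\star}$ denotes a signed Stirling number of the first kind and $\genfrac{\{}{\}}{0pt}{}{k}{j}$ denotes a Stirling number of the second kind, with the understanding that these two quantities are zero whenever $j<0$ or $j>k$.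
   Context: $\mathbb{N}=\{1,2,\ldots\}$ and $\mathbb{N}_0=\{0,1,2,\ldots\}$. $\mathsf{E}$ denotes expectation. The interior of the $d$-dimensional unit simplex is $\mathcal{S}_d^o=\{\boldsymbol{x}\in(0,1)^d:\sum_{i=1}^d x_i\in(0,1)\}$. Multinomial distribution: for $N\in\mathbb{N}$ and $\boldsymbol{p}\in\mathcal{S}_d^o$, a random vector $\boldsymbol{\xi}=(\xi_1,\dots,\xi_d)\sim\mathrm{Multinomial}(N,\boldsymbol{p})$ has probability mass function \[ p_{\boldsymbol{\xi}}(\boldsymbol{k})=\frac{N!}{(N-\sum_{i=1}^d k_i)!\prod_{i=1}^d k_i!}\Big(1-\sum_{i=1}^d p_i\Big)^{N-\sum_{i=1}^d k_i}\prod_{i=1}^d p_i^{k_i},\qquad \boldsymbol{k}\in\mathbb{N}_0^d,\ \sum_{i=1}^d k_i\le N. \] Stirling numbers: with falling factorials $x^{(0)}=1$ and $x^{(j)}=x(x-1)\cdots(x-j+1)$ for $j\in\mathbb{N}$, the signed Stirling numbers of the first kind $\genfrac{[}{]}{0pt}{}{k}{j}^{\star}$ and the Stirling numbers of the second kind $\genfrac{\{}{\}}{0pt}{}{\ell}{k}$ are the coefficients in \[ x^{(k)}=\sum_{j=0}^k\genfrac{[}{]}{0pt}{}{k}{j}^{\star}x^j,\qquad x^{\ell}=\sum_{k=0}^{\ell}\genfrac{\{}{\}}{0pt}{}{\ell}{k}x^{(k)},\qquad k,\ell\in\mathbb{N}_0. \] *)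

theory Defs
  imports "HOL-Probability.Probability" "HOL-Combinatorics.Stirling"
begin

text \<open>
  Vectors of dimension \<open>d\<close> are functions on a finite index type \<open>'d\<close>; types are
  nonempty, so \<open>d \<ge> 1\<close> holds automatically.
\<close>

definition simplex_interior :: "('d::finite \<Rightarrow> real) set" where
  "simplex_interior = {x. (\<forall>i. x i \<in> {0<..<1}) \<and> (\<Sum>i\<in>UNIV. x i) \<in> {0<..<1}}"

definition multinomial_mass :: "nat \<Rightarrow> ('d::finite \<Rightarrow> real) \<Rightarrow> ('d \<Rightarrow> nat) \<Rightarrow> real" where
  "multinomial_mass N p k =
     (if (\<Sum>i\<in>UNIV. k i) \<le> N then
        fact N / (fact (N - (\<Sum>i\<in>UNIV. k i)) * (\<Prod>i\<in>UNIV. fact (k i)))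
          * (1 - (\<Sum>i\<in>UNIV. p i)) ^ (N - (\<Sum>i\<in>UNIV. k i)) * (\<Prod>i\<in>UNIV. p i ^ k i)
      else 0)"

text \<open>The random vector \<open>X\<close> on the probability space \<open>M\<close> has law Multinomial(\<open>N\<close>, \<open>p\<close>).\<close>

definition multinomial_distributed ::
    "'a measure \<Rightarrow> ('a \<Rightarrow> 'd::finite \<Rightarrow> nat) \<Rightarrow> nat \<Rightarrow> ('d \<Rightarrow> real) \<Rightarrow> bool" where
  "multinomial_distributed M X N p \<longleftrightarrow>
     prob_space M \<and>
     distributed M (count_space UNIV) X (\<lambda>k. ennreal (multinomial_mass N p k))"

definition falling_poly :: "nat \<Rightarrow> int poly" where
  "falling_poly k = (\<Prod>i<k. [:- int i, 1:])"

text \<open>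
  The lower index is an integer because it may be negative in use; for \<open>j > k\<close> the
  coefficient vanishes by degree. Stirling numbers of the second kind are the library's
  \<^const>\<open>Stirling\<close>; lemma \<open>power_eq_sum_Stirling\<close> below confirms the convention.
\<close>

definition signed_stirling :: "nat \<Rightarrow> int \<Rightarrow> int" where
  "signed_stirling k j = (if j < 0 then 0 else coeff (falling_poly k) (nat j))"

lemma degree_falling_poly [simp]: "degree (falling_poly k) = k"
  unfolding falling_poly_def by (subst degree_prod_eq_sum_degree) auto

lemma poly_falling_poly:
  "poly (map_poly of_int (falling_poly k)) (x :: 'a :: comm_ring_1) = (\<Prod>i<k. x - of_nat i)"
proof (induction k)
  case 0
  show ?case by (simp add: falling_poly_def)
next
  case (Suc k)
  have "falling_poly (Suc k) = pCons 0 (falling_poly k) - smult (int k) (falling_poly k)"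
    by (simp add: falling_poly_def mult_ac)
  then have step: "map_poly (of_int :: int \<Rightarrow> 'a) (falling_poly (Suc k)) =
      pCons 0 (map_poly of_int (falling_poly k))
        - smult (of_nat k) (map_poly of_int (falling_poly k))"
    by (auto intro!: poly_eqI simp: coeff_map_poly coeff_pCons split: nat.splits)
  show ?case unfolding step using Suc by (simp add: algebra_simps)
qed

lemma falling_eq_sum_signed_stirling:
  "(\<Prod>i<k. x - of_nat i) =
     (\<Sum>j\<le>k. of_int (signed_stirling k (int j)) * (x :: 'a :: {comm_ring_1, ring_char_0}) ^ j)"
proof -
  have "degree (map_poly (of_int :: int \<Rightarrow> 'a) (falling_poly k)) = k"
    by (subst degree_map_poly) auto
  then show ?thesis
    by (simp add: poly_falling_poly [symmetric] poly_altdef coeff_map_poly signed_stirling_def)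
qed

lemma signed_stirling_eq_0: "j < 0 \<or> j > int k \<Longrightarrow> signed_stirling k j = 0"
  by (auto simp: signed_stirling_def intro!: coeff_eq_0)

lemma power_eq_sum_Stirling:
  "(x :: 'a :: comm_ring_1) ^ l = (\<Sum>k\<le>l. of_nat (Stirling l k) * (\<Prod>i<k. x - of_nat i))"
proof (induction l)
  case 0
  show ?case by simp
next
  case (Suc l)
  define f where "f k = (\<Prod>i<k. x - of_nat i)" for k
  have f: "x * f k = f (Suc k) + of_nat k * f k" for k
    by (simp add: f_def algebra_simps)
  have "x ^ Suc l = (\<Sum>k\<le>l. of_nat (Stirling l k) * (f (Suc k) + of_nat k * f k))"
    unfolding power_Suc Suc f_def [symmetric] sum_distrib_left f [symmetric]
    by (simp add: mult_ac)
  also have "\<dots> = (\<Sum>k\<le>l. of_nat (Stirling l k) * f (Suc k))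
                + (\<Sum>k\<le>Suc l. of_nat (k * Stirling l k) * f k)"
    by (simp add: sum.distrib algebra_simps)
  also have "(\<Sum>k\<le>Suc l. of_nat (k * Stirling l k) * f k) =
      (\<Sum>k\<le>l. of_nat (Suc k * Stirling l (Suc k)) * f (Suc k))"
    by (subst sum.atMost_Suc_shift) simp
  also have "(\<Sum>k\<le>l. of_nat (Stirling l k) * f (Suc k)) + \<dots> =
      (\<Sum>k\<le>l. of_nat (Stirling (Suc l) (Suc k)) * f (Suc k))"
    by (simp add: sum.distrib [symmetric] algebra_simps)
  also have "\<dots> = (\<Sum>k\<le>Suc l. of_nat (Stirling (Suc l) k) * f k)"
    by (subst sum.atMost_Suc_shift) simp
  finally show ?case by (simp add: f_def)
qed

text \<open>
  On \<^const>\<open>simplex_interior\<close> the mass function is clearly nonnegative; that it sums to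
  \<open>1\<close>, so that \<^const>\<open>multinomial_distributed\<close> is satisfiable, is shown here.
\<close>

lemma multinomial_theorem:
  fixes q :: real
  assumes "finite S"
  shows "(q + (\<Sum>i\<in>S. p i)) ^ N =
    (\<Sum>k\<in>{k \<in> S \<rightarrow>\<^sub>E (UNIV :: nat set). sum k S \<le> N}.
       fact N / (fact (N - sum k S) * (\<Prod>i\<in>S. fact (k i)))
         * q ^ (N - sum k S) * (\<Prod>i\<in>S. p i ^ k i))"
  using assms
proof (induction S arbitrary: q)
  case empty
  show ?case by simp
next
  case (insert a S)
  let ?A = "\<lambda>T. {k \<in> T \<rightarrow>\<^sub>E (UNIV :: nat set). sum k T \<le> N}"
  let ?t = "\<lambda>T q k. fact N / (fact (N - sum k T) * (\<Prod>i\<in>T. fact (k i)))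
         * q ^ (N - sum k T) * (\<Prod>i\<in>T. p i ^ k i) :: real"
  have fin: "finite (?A S)"
  proof (rule finite_subset)
    show "?A S \<subseteq> S \<rightarrow>\<^sub>E {..N}"
    proof
      fix k assume k: "k \<in> ?A S"
      have "k i \<le> N" if "i \<in> S" for i
        using member_le_sum [of i S k] insert.hyps(1) that k by simp
      with k show "k \<in> S \<rightarrow>\<^sub>E {..N}" by (simp add: PiE_iff)
    qed
    show "finite (S \<rightarrow>\<^sub>E {..N})" using insert.hyps by (intro finite_PiE) auto
  qed
  have upd: "sum (k(a := j)) S = sum k S" "(\<Prod>i\<in>S. g i ((k(a := j)) i)) = (\<Prod>i\<in>S. g i (k i))"
    for k :: "_ \<Rightarrow> nat" and j and g :: "_ \<Rightarrow> nat \<Rightarrow> real"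
  proof -
    have "(k(a := j)) i = k i" if "i \<in> S" for i
      using that insert.hyps by auto
    then show "sum (k(a := j)) S = sum k S"
      "(\<Prod>i\<in>S. g i ((k(a := j)) i)) = (\<Prod>i\<in>S. g i (k i))"
      by (simp_all cong: sum.cong prod.cong)
  qed
  have cancel: "F / (A * P) * (A / (x * y) * u * v) * w = F / (y * (x * P)) * v * (u * w)"
    if "A \<noteq> 0" for F A P x y u v w :: real
    using that by (simp add: mult_ac)
  have step: "?t S (q + p a) k = (\<Sum>j\<le>N - sum k S. ?t (insert a S) q (k(a := j)))"
    if "k \<in> ?A S" for k
  proof -
    have "(q + p a) ^ (N - sum k S) =
        (\<Sum>j\<le>N - sum k S. fact (N - sum k S) / (fact j * fact (N - sum k S - j))
             * p a ^ j * q ^ (N - sum k S - j))"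
      using binomial_ring [of "p a" q "N - sum k S"] by (simp add: binomial_fact add.commute)
    then have "?t S (q + p a) k =
        (\<Sum>j\<le>N - sum k S. fact N / (fact (N - sum k S) * (\<Prod>i\<in>S. fact (k i)))
         * (fact (N - sum k S) / (fact j * fact (N - sum k S - j))
             * p a ^ j * q ^ (N - sum k S - j)) * (\<Prod>i\<in>S. p i ^ k i))"
      by (simp only: sum_distrib_left sum_distrib_right)
    also have "\<dots> = (\<Sum>j\<le>N - sum k S. ?t (insert a S) q (k(a := j)))"
    proof (intro sum.cong refl)
      fix j
      have s: "sum (k(a := j)) (insert a S) = j + sum k S"
        using insert.hyps upd(1) [of k j] by simp
      have f: "(\<Prod>i\<in>insert a S. fact ((k(a := j)) i)) = (fact j * (\<Prod>i\<in>S. fact (k i)) :: real)"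
        using insert.hyps upd(2) [of "\<lambda>_ n. fact n" k j] by simp
      have p: "(\<Prod>i\<in>insert a S. p i ^ (k(a := j)) i) = p a ^ j * (\<Prod>i\<in>S. p i ^ k i)"
        using insert.hyps upd(2) [of "\<lambda>i n. p i ^ n" k j] by simp
      have d: "N - (j + sum k S) = N - sum k S - j" by simp
      show "fact N / (fact (N - sum k S) * (\<Prod>i\<in>S. fact (k i)))
         * (fact (N - sum k S) / (fact j * fact (N - sum k S - j))
             * p a ^ j * q ^ (N - sum k S - j)) * (\<Prod>i\<in>S. p i ^ k i) =
           ?t (insert a S) q (k(a := j))"
        unfolding s f p d by (rule cancel) simp
    qed
    finally show ?thesis .
  qed
  have "(q + (\<Sum>i\<in>insert a S. p i)) ^ N = ((q + p a) + (\<Sum>i\<in>S. p i)) ^ N"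
    using insert.hyps by (simp add: add_ac)
  also have "\<dots> = (\<Sum>k\<in>?A S. ?t S (q + p a) k)" by (rule insert.IH)
  also have "\<dots> = (\<Sum>k\<in>?A S. \<Sum>j\<le>N - sum k S. ?t (insert a S) q (k(a := j)))"
    by (intro sum.cong refl step)
  also have "\<dots> = (\<Sum>(k, j)\<in>(SIGMA k:?A S. {..N - sum k S}). ?t (insert a S) q (k(a := j)))"
    using fin by (intro sum.Sigma) auto
  also have "\<dots> = (\<Sum>k\<in>?A (insert a S). ?t (insert a S) q k)"
  proof (rule sum.reindex_bij_witness
      [where j = "\<lambda>(k, j). k(a := j)" and i = "\<lambda>k. (k(a := undefined), k a)"], goal_cases)
    case (1 x)
    then show ?case using insert.hyps by (auto simp: PiE_iff extensional_def)
  next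
    case (2 x)
    obtain k j where x: "x = (k, j)" by (cases x)
    with 2 have "sum (k(a := j)) (insert a S) = j + sum k S"
      using insert.hyps upd(1) [of k j] by simp
    moreover have "k(a := j) \<in> insert a S \<rightarrow>\<^sub>E UNIV"
      using 2 x by (auto simp: PiE_iff extensional_def)
    moreover have "j + sum k S \<le> N" using 2 x by auto
    ultimately show ?case using x by simp
  next
    case (3 k)
    then show ?case by simp
  next
    case (4 k)
    then have "k(a := undefined) \<in> S \<rightarrow>\<^sub>E UNIV" by (auto simp: PiE_iff extensional_def)
    moreover have "k a + sum k S \<le> N" using 4 insert.hyps by simp
    ultimately show ?case using upd(1) [of k undefined] by simp
  next
    case (5 x)
    then show ?case by (cases x) simp
  qed
  finally show ?case .
qed

lemma sum_multinomial_mass: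
  "(\<Sum>k\<in>{k. (\<Sum>i\<in>UNIV. k i) \<le> N}. multinomial_mass N p k) = 1"
  using multinomial_theorem [of UNIV "1 - (\<Sum>i\<in>UNIV. p i)" p N]
  by (simp add: multinomial_mass_def)

end

theory Submission
  imports Defs
begin

text \<open>
  The difference in the theorem has a limit, and this limit is exactly the displayed double sum; the
  equivalence of the two sign conditions is then immediate.

  Why the limit is the double sum: expand each \<open>(\<xi>\<^sub>i - N p\<^sub>i)^(2m)\<close> by the binomial theorem and
  the powers of \<open>\<xi>\<^sub>i\<close> into falling factorials by Stirling numbers of the second kind. Mixed factorial
  moments of a multinomial vector are explicit (\<open>multinomial_factorial_moment\<close>): with
  \<open>K = \<Sum>i. k\<^sub>i\<close> they equal the falling factorial \<open>N (N - 1) \<cdots> (N - K + 1)\<close> times \<open>\<Prod>i. p\<^sub>i^k\<^sub>i\<close>.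
  So the joint central moment is a polynomial in \<open>N\<close>, and Stirling numbers of the first kind give its
  coefficients. The normalisation divides by \<open>N^(md)\<close>, so lower powers
  of \<open>N\<close> vanish in the limit and the coefficient of \<open>N^(md)\<close> remains; it collects the terms with
  \<open>j = \<Sum>i. l\<^sub>i - md\<close> in the first-kind expansion. The same computation for one coordinate
  gives the coefficient of \<open>N^m\<close>, and the product over the coordinates of these coefficients is the
  subtracted term.

  What has to be proved is that higher powers of \<open>N\<close> cancel, although each summand has
  degree up to \<open>2md\<close>. A polynomial bounded by a multiple of \<open>N^e\<close> at the positive integers has no
  higher powers (\<open>poly_over_power_tendsto_coeff_bounded\<close>), so bounds on the moments
  suffice. For a single coordinate, conditioning on the last trial gives a recurrence in \<open>N\<close> in which
  the increment of the \<open>r\<close>-th central moment involves only moments of order at most \<open>r - 2\<close>, because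
  one centred trial has mean \<open>0\<close>; summing gives order \<open>N^(r div 2)\<close>
  (\<open>central_moment_bound\<close>). The joint moment is dominated by a sum of
  one-coordinate moments of order \<open>2md\<close> (\<open>joint_moment_bound\<close>).
\<close>

section \<open>Multinomial expectations as finite sums\<close>

definition multinomial_mean :: "nat \<Rightarrow> ('d::finite \<Rightarrow> real) \<Rightarrow> (('d \<Rightarrow> nat) \<Rightarrow> real) \<Rightarrow> real" where
  "multinomial_mean N p g = (\<Sum>k | (\<Sum>i\<in>UNIV. k i) \<le> N. multinomial_mass N p k * g k)"

lemma finite_bounded_sum: "finite {k :: 'd::finite \<Rightarrow> nat. (\<Sum>i\<in>UNIV. k i) \<le> N}"
proof (rule finite_subset)
  have "k i \<le> (\<Sum>i\<in>UNIV. k i)" for k :: "'d \<Rightarrow> nat" and i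
    by (rule member_le_sum) auto
  then show "{k :: 'd \<Rightarrow> nat. (\<Sum>i\<in>UNIV. k i) \<le> N} \<subseteq> PiE UNIV (\<lambda>_. {..N})"
    by (auto intro: order_trans)
qed (auto intro: finite_PiE)

lemma multinomial_mass_nonneg:
  assumes "p \<in> simplex_interior"
  shows "multinomial_mass N p k \<ge> 0"
proof -
  have "0 \<le> 1 - (\<Sum>i\<in>UNIV. p i)" "\<And>i. 0 \<le> p i"
    using assms by (auto simp: simplex_interior_def less_imp_le)
  then show ?thesis
    unfolding multinomial_mass_def
    by (auto intro!: mult_nonneg_nonneg divide_nonneg_nonneg prod_nonneg zero_le_power)
qed

lemma integral_multinomial:
  fixes p :: "'d::finite \<Rightarrow> real"
  assumes p: "p \<in> simplex_interior" and X: "multinomial_distributed M X N p"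
  shows "(\<integral>\<omega>. g (X \<omega>) \<partial>M) = multinomial_mean N p g"
proof -
  have "(\<integral>\<omega>. g (X \<omega>) \<partial>M) = (\<integral>k. multinomial_mass N p k * g k \<partial>count_space UNIV)"
    using distributed_integral [of M "count_space UNIV" X "multinomial_mass N p" g]
      X multinomial_mass_nonneg [OF p] by (simp add: multinomial_distributed_def)
  also have "\<dots> = multinomial_mean N p g"
  proof -
    let ?f = "\<lambda>k. multinomial_mass N p k * g k"
    have sub: "{k. ?f k \<noteq> 0} \<subseteq> {k. (\<Sum>i\<in>UNIV. k i) \<le> N}"
      by (auto simp: multinomial_mass_def split: if_splits)
    then have "finite {k. ?f k \<noteq> 0}"
      using finite_bounded_sum by (rule finite_subset)
    then have "(\<integral>k. ?f k \<partial>count_space UNIV) = (\<Sum>k | ?f k \<noteq> 0. ?f k)"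
      using lebesgue_integral_count_space_finite_support [of UNIV ?f] by simp
    also have "\<dots> = (\<Sum>k | (\<Sum>i\<in>UNIV. k i) \<le> N. ?f k)"
      using sub finite_bounded_sum by (intro sum.mono_neutral_left) auto
    finally show ?thesis by (simp add: multinomial_mean_def)
  qed
  finally show ?thesis .
qed

lemma multinomial_mean_cmult:
  "multinomial_mean N p (\<lambda>k. c * g k) = c * multinomial_mean N p g"
  by (simp add: multinomial_mean_def sum_distrib_left mult_ac)

lemma multinomial_mean_add:
  "multinomial_mean N p (\<lambda>k. f k + g k) = multinomial_mean N p f + multinomial_mean N p g"
  by (simp add: multinomial_mean_def sum.distrib distrib_left)

lemma multinomial_mean_sum:
  "multinomial_mean N p (\<lambda>k. \<Sum>a\<in>A. g a k) = (\<Sum>a\<in>A. multinomial_mean N p (g a))"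
  unfolding multinomial_mean_def sum_distrib_left by (rule sum.swap)

lemma multinomial_mean_mono:
  assumes "p \<in> simplex_interior" and "\<And>k. f k \<le> g k"
  shows "multinomial_mean N p f \<le> multinomial_mean N p g"
  unfolding multinomial_mean_def
  using assms multinomial_mass_nonneg by (intro sum_mono mult_left_mono) auto

section \<open>Factorial moments\<close>

definition falling :: "real \<Rightarrow> nat \<Rightarrow> real" where
  "falling x n = (\<Prod>j<n. x - real j)"

lemma falling_0 [simp]: "falling x 0 = 1"
  by (simp add: falling_def)

lemma falling_Suc: "falling x (Suc n) = falling x n * (x - real n)"
  by (simp add: falling_def)

lemma falling_Suc_shift: "falling (x + 1) (Suc n) = (x + 1) * falling x n"
  unfolding falling_def prod.lessThan_Suc_shift by (simp add: algebra_simps)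

lemma falling_of_nat:
  "falling (real n) k = (if k \<le> n then fact n / fact (n - k) else 0)"
proof (cases "k \<le> n")
  case True
  then show ?thesis
  proof (induction k)
    case (Suc k)
    then have "n - k = Suc (n - Suc k)" by simp
    then have "fact (n - k) = real (n - k) * fact (n - Suc k)"
      by (metis fact_Suc)
    with Suc show ?case by (simp add: falling_Suc of_nat_diff)
  qed simp
next
  case False
  then show ?thesis by (auto simp: falling_def)
qed

text \<open>
  In \<open>k! / (k - a)!\<close> times the mass at \<open>k\<close>, the factorials \<open>k!\<close> cancel; what remains is, up to
  a constant, the mass at \<open>k - a\<close> for \<open>N - \<Sum>i. a i\<close> trials, and these masses sum to \<open>1\<close>.
\<close>

lemma multinomial_factorial_moment:
  fixes p :: "'d::finite \<Rightarrow> real"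
  shows "multinomial_mean N p (\<lambda>k. \<Prod>i\<in>UNIV. falling (real (k i)) (a i)) =
    falling (real N) (\<Sum>i\<in>UNIV. a i) * (\<Prod>i\<in>UNIV. p i ^ a i)"
proof (cases "(\<Sum>i\<in>UNIV. a i) \<le> N")
  case False
  have "\<exists>i. k i < a i" if "(\<Sum>i\<in>UNIV. k i) \<le> N" for k
  proof (rule ccontr)
    assume "\<nexists>i. k i < a i"
    then have "(\<Sum>i\<in>UNIV. a i) \<le> (\<Sum>i\<in>UNIV. k i)"
      by (intro sum_mono) (simp add: not_less)
    with that False show False by simp
  qed
  then have "(\<Prod>i\<in>UNIV. falling (real (k i)) (a i)) = 0" if "(\<Sum>i\<in>UNIV. k i) \<le> N" for k
    using that by (subst prod_zero_iff) (auto simp: falling_of_nat not_le)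
  then have "multinomial_mean N p (\<lambda>k. \<Prod>i\<in>UNIV. falling (real (k i)) (a i)) = 0"
    unfolding multinomial_mean_def by (intro sum.neutral) simp
  then show ?thesis
    using False by (simp add: falling_of_nat)
next
  case True
  define s where "s = (\<Sum>i\<in>UNIV. a i)"
  let ?g = "\<lambda>k. \<Prod>i\<in>UNIV. falling (real (k i)) (a i)"
  let ?c = "falling (real N) s * (\<Prod>i\<in>UNIV. p i ^ a i)"
  have s: "s \<le> N" using True by (simp add: s_def)
  have "multinomial_mean N p ?g =
      (\<Sum>k | (\<Sum>i\<in>UNIV. k i) \<le> N \<and> (\<forall>i. a i \<le> k i). multinomial_mass N p k * ?g k)"
    unfolding multinomial_mean_def using finite_bounded_sum
  proof (intro sum.mono_neutral_right ballI)
    fix k assume "k \<in> {k. (\<Sum>i\<in>UNIV. k i) \<le> N} - {k. (\<Sum>i\<in>UNIV. k i) \<le> N \<and> (\<forall>i. a i \<le> k i)}"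
    then obtain i where "\<not> a i \<le> k i" by auto
    then have "?g k = 0" by (subst prod_zero_iff) (auto simp: falling_of_nat)
    then show "multinomial_mass N p k * ?g k = 0" by simp
  qed auto
  also have "\<dots> = (\<Sum>k | (\<Sum>i\<in>UNIV. k i) \<le> N - s. ?c * multinomial_mass (N - s) p k)"
  proof (rule sum.reindex_bij_witness
      [where i = "\<lambda>k i. k i + a i" and j = "\<lambda>k i. k i - a i"], goal_cases)
    case (2 k)
    then have "(\<Sum>i\<in>UNIV. k i - a i) = (\<Sum>i\<in>UNIV. k i) - s"
      unfolding s_def by (intro sum_subtractf_nat) auto
    with 2 show ?case by (simp add: diff_le_mono)
  next
    case (4 k)
    with s show ?case by (simp add: sum.distrib s_def)
  next
    case (5 k)
    define h where "h i = k i - a i" for i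
    have k: "k = (\<lambda>i. h i + a i)" using 5 by (auto simp: h_def)
    have sk: "(\<Sum>i\<in>UNIV. k i) = (\<Sum>i\<in>UNIV. h i) + s"
      by (simp add: k sum.distrib s_def)
    have f: "falling (real (k i)) (a i) = fact (k i) / fact (h i)" for i
      using 5 by (simp add: falling_of_nat h_def)
    have fk: "?g k = (\<Prod>i\<in>UNIV. fact (k i)) / (\<Prod>i\<in>UNIV. fact (h i))"
      unfolding f by (rule prod_dividef)
    have nz: "(\<Prod>i\<in>UNIV. fact (k i)) \<noteq> (0 :: real)" by simp
    have pk: "(\<Prod>i\<in>UNIV. p i ^ k i) = (\<Prod>i\<in>UNIV. p i ^ h i) * (\<Prod>i\<in>UNIV. p i ^ a i)"
      by (simp add: k power_add prod.distrib)
    have d: "N - (\<Sum>i\<in>UNIV. k i) = N - s - (\<Sum>i\<in>UNIV. h i)"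
      using sk by simp
    have le: "(\<Sum>i\<in>UNIV. k i) \<le> N" "(\<Sum>i\<in>UNIV. h i) \<le> N - s" using 5 sk by auto
    have "multinomial_mass N p k * ?g k = ?c * multinomial_mass (N - s) p h"
      unfolding multinomial_mass_def falling_of_nat [of N s] fk pk d using le s nz
      by (simp add: d [symmetric] field_simps)
    moreover have "h = (\<lambda>i. k i - a i)" by (auto simp: h_def)
    ultimately show ?case by simp
  qed auto
  also have "\<dots> = ?c"
    by (simp add: sum_distrib_left [symmetric] sum_multinomial_mass)
  finally show ?thesis by (simp add: s_def)
qed

lemma multinomial_marginal_factorial_moment:
  fixes p :: "'d::finite \<Rightarrow> real"
  shows "multinomial_mean N p (\<lambda>k. falling (real (k i)) n) = falling (real N) n * p i ^ n"
proof -
  let ?a = "\<lambda>j. if j = i then n else 0"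
  have 1: "(\<Prod>j\<in>UNIV. falling (real (k j)) (?a j)) = falling (real (k i)) n" for k :: "'d \<Rightarrow> nat"
    by (subst prod.remove [of _ i]) auto
  have 2: "(\<Prod>j\<in>UNIV. p j ^ ?a j) = p i ^ n"
    by (subst prod.remove [of _ i]) auto
  show ?thesis
    using multinomial_factorial_moment [of N p ?a] unfolding 1 2 by simp
qed

section \<open>Growth of the central moments of one coordinate\<close>

text \<open>
  Conditioning on the last trial: coordinate \<open>i\<close> grows by one with probability \<open>p i\<close>. This is obtained
  for factorial moments first, where it is the Pascal rule for falling factorials, and
  extends by linearity to all powers.
\<close>

lemma multinomial_mean_Suc:
  fixes p :: "'d::finite \<Rightarrow> real"
  shows "multinomial_mean (Suc N) p (\<lambda>k. (real (k i) - c) ^ r) =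
    multinomial_mean N p (\<lambda>k. p i * (real (k i) + 1 - c) ^ r + (1 - p i) * (real (k i) - c) ^ r)"
proof -
  \<comment> \<open>\<open>B f\<close>: the one-step formula holds for \<open>f\<close> in place of the shifted power.\<close>
  define B where "B f \<longleftrightarrow> multinomial_mean (Suc N) p (\<lambda>k. f (real (k i))) =
    multinomial_mean N p (\<lambda>k. p i * f (real (k i) + 1) + (1 - p i) * f (real (k i)))"
    for f :: "real \<Rightarrow> real"
  have cmult: "B (\<lambda>x. b * f x)" if "B f" for b f
    using that by (simp add: B_def multinomial_mean_add multinomial_mean_cmult distrib_left
      mult.left_commute [of _ b])
  have sum: "B (\<lambda>x. \<Sum>a\<in>A. f a x)" if "\<And>a. a \<in> A \<Longrightarrow> B (f a)" for A :: "nat set" and f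
    using that by (simp add: B_def multinomial_mean_add multinomial_mean_cmult
      multinomial_mean_sum sum.distrib sum_distrib_left)
  have fall: "B (\<lambda>x. falling x n)" for n
  proof (cases n)
    case 0
    then show ?thesis
      using multinomial_marginal_factorial_moment [of "Suc N" p i 0]
        multinomial_marginal_factorial_moment [of N p i 0] by (simp add: B_def)
  next
    case (Suc l)
    have "p i * falling (x + 1) n + (1 - p i) * falling x n
        = falling x n + (p i * real n) * falling x l" for x
      unfolding Suc falling_Suc_shift falling_Suc [of x] by (simp add: algebra_simps)
    moreover have "falling (real (Suc N)) n = falling (real N) n + real n * falling (real N) l"
      using falling_Suc_shift [of "real N" l]
      by (simp add: Suc falling_Suc [of "real N"] algebra_simps)
    ultimately show ?thesis
      unfolding B_def
      by (simp add: multinomial_mean_add multinomial_mean_cmult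
        multinomial_marginal_factorial_moment del: of_nat_Suc) (simp add: Suc algebra_simps)
  qed
  have "B (\<lambda>x. \<Sum>k\<le>l. real (Stirling l k) * falling x k)" for l
    by (intro sum cmult fall)
  then have pow: "B (\<lambda>x. x ^ l)" for l
    by (simp add: power_eq_sum_Stirling falling_def)
  have "B (\<lambda>x. \<Sum>l\<le>r. (real (r choose l) * (- c) ^ (r - l)) * x ^ l)"
    by (intro sum cmult pow)
  moreover have "(\<Sum>l\<le>r. (real (r choose l) * (- c) ^ (r - l)) * x ^ l) = (x - c) ^ r" for x
    using binomial_ring [of x "- c" r] by (simp add: mult_ac)
  ultimately show ?thesis by (simp add: B_def)
qed

definition central_moment :: "('d::finite \<Rightarrow> real) \<Rightarrow> 'd \<Rightarrow> nat \<Rightarrow> nat \<Rightarrow> real" where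
  "central_moment p i r N = multinomial_mean N p (\<lambda>k. (real (k i) - real N * p i) ^ r)"

lemma central_moment_0: "central_moment p i 0 N = 1"
  using multinomial_marginal_factorial_moment [of N p i 0] by (simp add: central_moment_def)

text \<open>
  The factor in front of the moment of order \<open>s\<close> is \<open>r choose s\<close> times the moment of order \<open>r - s\<close> of
  one centred trial. Hence it is \<open>1\<close> for \<open>s = r\<close> and \<open>0\<close> for \<open>s + 1 = r\<close>.
\<close>

lemma central_moment_Suc:
  "central_moment p i r (Suc N) =
    (\<Sum>s\<le>r. (real (r choose s) * (p i * (1 - p i) ^ (r - s) + (1 - p i) * (- p i) ^ (r - s)))
      * central_moment p i s N)"
proof -
  have "p i * (real x + 1 - real (Suc N) * p i) ^ r + (1 - p i) * (real x - real (Suc N) * p i) ^ r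
    = (\<Sum>s\<le>r. (real (r choose s) * (p i * (1 - p i) ^ (r - s) + (1 - p i) * (- p i) ^ (r - s)))
        * (real x - real N * p i) ^ s)" for x :: nat
  proof -
    let ?y = "real x - real N * p i"
    have 1: "real x + 1 - real (Suc N) * p i = ?y + (1 - p i)"
      "real x - real (Suc N) * p i = ?y + (- p i)"
      by (simp_all add: algebra_simps)
    show ?thesis
      unfolding 1 binomial_ring sum_distrib_left sum.distrib [symmetric]
      by (intro sum.cong refl) (simp add: algebra_simps)
  qed
  then show ?thesis
    unfolding central_moment_def multinomial_mean_Suc
    by (simp only: multinomial_mean_sum multinomial_mean_cmult)
qed

text \<open>
  By induction on \<open>r\<close>: the increment in \<open>N\<close> of the \<open>r\<close>-th moment is a combination of moments of
  order at most \<open>r - 2\<close>, hence of order \<open>N^((r - 2) div 2)\<close>, and summing over \<open>N\<close> raises the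
  exponent by one. The shift \<open>N + 1\<close> avoids a special case at \<open>N = 0\<close>.
\<close>

lemma central_moment_bound:
  "\<exists>C. \<forall>N. \<bar>central_moment p i r N\<bar> \<le> C * (real N + 1) ^ (r div 2)"
proof (induction r rule: less_induct)
  case (less r)
  consider "r = 0" | "r = 1" | n where "r = Suc (Suc n)"
    by (metis One_nat_def not0_implies_Suc)
  then show ?case
  proof cases
    case 1
    then show ?thesis by (auto simp: central_moment_0 intro: exI [of _ 1])
  next
    case 2
    have "central_moment p i 1 N = central_moment p i 1 0" for N
      by (induction N) (simp_all add: central_moment_Suc algebra_simps)
    then have "\<bar>central_moment p i r N\<bar> \<le> \<bar>central_moment p i 1 0\<bar> * (real N + 1) ^ (r div 2)" for N
      using 2 by (metis div_less mult.right_neutral one_less_numeral_iff order_refl power_0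
        semiring_norm(76))
    then show ?thesis by blast
  next
    case (3 n)
    define w where "w s = real (r choose s)
      * (p i * (1 - p i) ^ (r - s) + (1 - p i) * (- p i) ^ (r - s))" for s
    have "\<forall>s\<in>{..n}. \<exists>C. \<forall>N. \<bar>central_moment p i s N\<bar> \<le> C * (real N + 1) ^ (s div 2)"
      using less 3 by auto
    then obtain C where C: "\<And>s N. s \<le> n \<Longrightarrow>
        \<bar>central_moment p i s N\<bar> \<le> C s * (real N + 1) ^ (s div 2)"
      by (metis atMost_iff)
    define K where "K = (\<Sum>s\<le>n. \<bar>w s\<bar> * \<bar>C s\<bar>)"
    define h where "h = n div 2"
    have K: "K \<ge> 0" by (simp add: K_def sum_nonneg)
    have step: "\<bar>central_moment p i r (Suc N) - central_moment p i r N\<bar> \<le> K * (real N + 1) ^ h" for N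
    proof -
      have "central_moment p i r (Suc N) = (\<Sum>s\<le>Suc (Suc n). w s * central_moment p i s N)"
        by (simp only: central_moment_Suc w_def 3)
      \<comment> \<open>\<open>w\<close> vanishes at \<open>r - 1\<close> since a centred trial has mean \<open>0\<close>, and is \<open>1\<close> at \<open>r\<close>.\<close>
      also have "\<dots> = (\<Sum>s\<le>n. w s * central_moment p i s N) + central_moment p i r N"
        using 3 by (simp add: w_def)
      finally have "\<bar>central_moment p i r (Suc N) - central_moment p i r N\<bar>
          \<le> (\<Sum>s\<le>n. \<bar>w s * central_moment p i s N\<bar>)"
        by (simp add: sum_abs)
      also have "\<dots> \<le> (\<Sum>s\<le>n. \<bar>w s\<bar> * \<bar>C s\<bar> * (real N + 1) ^ h)"
      proof (rule sum_mono)
        fix s assume s: "s \<in> {..n}"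
        then have "\<bar>central_moment p i s N\<bar> \<le> C s * (real N + 1) ^ (s div 2)"
          using C by simp
        also have "\<dots> \<le> \<bar>C s\<bar> * (real N + 1) ^ h"
          using s by (intro mult_mono power_increasing) (auto simp: h_def intro: div_le_mono)
        finally show "\<bar>w s * central_moment p i s N\<bar> \<le> \<bar>w s\<bar> * \<bar>C s\<bar> * (real N + 1) ^ h"
          by (simp add: abs_mult mult.assoc mult_left_mono)
      qed
      finally show ?thesis by (simp add: K_def sum_distrib_right)
    qed
    have "\<bar>central_moment p i r N\<bar> \<le> \<bar>central_moment p i r 0\<bar> + real N * K * (real N + 1) ^ h" for N
    proof (induction N)
      case (Suc N)
      have "\<bar>central_moment p i r (Suc N)\<bar>
          \<le> \<bar>central_moment p i r 0\<bar> + (real (Suc N) * K) * (real N + 1) ^ h"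
        using Suc step [of N] by (simp add: algebra_simps)
      also have "\<dots> \<le> \<bar>central_moment p i r 0\<bar> + (real (Suc N) * K) * (real (Suc N) + 1) ^ h"
        using K by (intro add_left_mono mult_left_mono power_mono) auto
      finally show ?case .
    qed simp
    also have "\<bar>central_moment p i r 0\<bar> + real N * K * (real N + 1) ^ h
        \<le> (\<bar>central_moment p i r 0\<bar> + K) * (real N + 1) ^ (r div 2)" for N
    proof -
      have "\<bar>central_moment p i r 0\<bar> * 1 \<le> \<bar>central_moment p i r 0\<bar> * (real N + 1) ^ (r div 2)"
        by (intro mult_left_mono one_le_power) auto
      moreover have "real N * K * (real N + 1) ^ h \<le> (real N + 1) * K * (real N + 1) ^ h"
        using K by (intro mult_right_mono) auto
      moreover have "r div 2 = Suc h" by (simp add: 3 h_def)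
      ultimately show ?thesis by (simp add: algebra_simps)
    qed
    finally show ?thesis by blast
  qed
qed

lemma central_moment_bound_even:
  "\<exists>C. \<forall>N\<ge>1. \<bar>central_moment p i (2 * n) N\<bar> \<le> C * real N ^ n"
proof -
  obtain C where C: "\<And>N. \<bar>central_moment p i (2 * n) N\<bar> \<le> C * (real N + 1) ^ n"
    using central_moment_bound [of p i "2 * n"] by auto
  have "\<bar>central_moment p i (2 * n) N\<bar> \<le> (\<bar>C\<bar> * 2 ^ n) * real N ^ n" if "N \<ge> 1" for N
  proof -
    have "\<bar>central_moment p i (2 * n) N\<bar> \<le> C * (real N + 1) ^ n" by (rule C)
    also have "\<dots> \<le> \<bar>C\<bar> * (2 * real N) ^ n"
      using that by (intro mult_mono power_mono) auto
    finally show ?thesis by (simp add: power_mult_distrib mult_ac)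
  qed
  then show ?thesis by blast
qed

section \<open>Growth of the joint central moment\<close>

definition joint_moment :: "('d::finite \<Rightarrow> real) \<Rightarrow> nat \<Rightarrow> nat \<Rightarrow> real" where
  "joint_moment p r N = multinomial_mean N p (\<lambda>k. \<Prod>i\<in>UNIV. (real (k i) - real N * p i) ^ r)"

text \<open>
  A crude substitute for the inequality between arithmetic and geometric means: the product is at
  most the corresponding power of the largest factor.
\<close>

lemma prod_le_sum_power:
  fixes a :: "'d::finite \<Rightarrow> real"
  assumes "\<And>i. a i \<ge> 0"
  shows "(\<Prod>i\<in>UNIV. a i) \<le> (\<Sum>i\<in>UNIV. a i ^ CARD('d))"
proof -
  have "Max (range a) \<in> range a" by (intro Max_in) auto
  then obtain i where i: "Max (range a) = a i" by (rule rangeE)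
  then have "a j \<le> a i" for j by (metis Max_ge finite finite_imageI rangeI)
  then have "(\<Prod>j\<in>UNIV. a j) \<le> (\<Prod>j\<in>(UNIV :: 'd set). a i)"
    using assms by (intro prod_mono) auto
  also have "\<dots> = a i ^ CARD('d)" by simp
  also have "\<dots> \<le> (\<Sum>j\<in>UNIV. a j ^ CARD('d))"
    using assms by (intro member_le_sum) auto
  finally show ?thesis .
qed

text \<open>
  The even powers are nonnegative, so the joint moment is at most the sum over \<open>i\<close> of the one-coordinate
  central moments of order \<open>2md\<close>. This keeps the recurrence in \<open>N\<close> one-dimensional.
\<close>

lemma joint_moment_bound:
  fixes p :: "'d::finite \<Rightarrow> real"
  assumes p: "p \<in> simplex_interior"
  shows "\<exists>C. \<forall>N\<ge>1. \<bar>joint_moment p (2 * m) N\<bar> \<le> C * real N ^ (m * CARD('d))"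
proof -
  obtain C where C: "\<And>i N. N \<ge> 1 \<Longrightarrow>
      \<bar>central_moment p i (2 * (m * CARD('d))) N\<bar> \<le> C i * real N ^ (m * CARD('d))"
    using central_moment_bound_even [of p _ "m * CARD('d)"] by metis
  have "\<bar>joint_moment p (2 * m) N\<bar> \<le> (\<Sum>i\<in>UNIV. C i) * real N ^ (m * CARD('d))" if "N \<ge> 1" for N
  proof -
    let ?y = "\<lambda>k i. real (k i) - real N * p i"
    \<comment> \<open>The zero function is written as a product so that \<open>multinomial_mean_cmult\<close> applies.\<close>
    have "multinomial_mean N p (\<lambda>k. 0 * 0) \<le> joint_moment p (2 * m) N"
      unfolding joint_moment_def using p by (intro multinomial_mean_mono) (auto intro: prod_nonneg)
    then have "\<bar>joint_moment p (2 * m) N\<bar> = joint_moment p (2 * m) N"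
      unfolding multinomial_mean_cmult by simp
    also have "\<dots> \<le> multinomial_mean N p (\<lambda>k. \<Sum>i\<in>UNIV. (?y k i ^ (2 * m)) ^ CARD('d))"
      unfolding joint_moment_def using p
      by (intro multinomial_mean_mono prod_le_sum_power) auto
    also have "\<dots> = (\<Sum>i\<in>UNIV. central_moment p i (2 * (m * CARD('d))) N)"
      by (simp add: multinomial_mean_sum central_moment_def power_mult [symmetric] mult.assoc)
    also have "\<dots> \<le> (\<Sum>i\<in>UNIV. C i * real N ^ (m * CARD('d)))"
      using C [OF that] by (intro sum_mono) (meson abs_le_D1)
    finally show ?thesis by (simp add: sum_distrib_right)
  qed
  then show ?thesis by blast
qed

section \<open>Limits of normalised polynomials in the number of trials\<close>

lemma poly_over_power_tendsto_coeff:
  fixes P :: "real poly"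
  assumes "degree P \<le> n"
  shows "(\<lambda>N. poly P (real N) / real N ^ n) \<longlonglongrightarrow> coeff P n"
proof -
  have "(\<lambda>N. \<Sum>i\<le>n. coeff P i * (1 / real N) ^ (n - i)) \<longlonglongrightarrow> (\<Sum>i\<le>n. coeff P i * 0 ^ (n - i))"
    by (intro tendsto_intros lim_1_over_n)
  also have "(\<Sum>i\<le>n. coeff P i * 0 ^ (n - i)) = (\<Sum>i\<le>n. if i = n then coeff P i else 0)"
    by (intro sum.cong) auto
  also have "\<dots> = coeff P n" by simp
  finally show ?thesis
  proof (rule Lim_transform_eventually)
    show "\<forall>\<^sub>F N in sequentially.
      (\<Sum>i\<le>n. coeff P i * (1 / real N) ^ (n - i)) = poly P (real N) / real N ^ n"
      using eventually_gt_at_top [of 0]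
    proof eventually_elim
      case (elim N)
      have "poly P (real N) = (\<Sum>i\<le>n. coeff P i * real N ^ i)"
        unfolding poly_altdef using assms
        by (intro sum.mono_neutral_left) (auto intro: coeff_eq_0)
      also have "\<dots> / real N ^ n = (\<Sum>i\<le>n. coeff P i * (1 / real N) ^ (n - i))"
        unfolding sum_divide_distrib using elim
        by (intro sum.cong refl) (simp add: power_diff power_divide)
      finally show ?case ..
    qed
  qed
qed

text \<open>
  If the degree \<open>n\<close> of \<open>P\<close> exceeded \<open>e\<close>, then \<open>P(N) / N^n\<close> would tend to the leading coefficient, but
  also to \<open>0\<close> because of the bound.
\<close>

lemma poly_over_power_tendsto_coeff_bounded:
  fixes P :: "real poly"
  assumes "\<And>N. N \<ge> 1 \<Longrightarrow> \<bar>poly P (real N)\<bar> \<le> C * real N ^ e"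
  shows "(\<lambda>N. poly P (real N) / real N ^ e) \<longlonglongrightarrow> coeff P e"
proof (rule poly_over_power_tendsto_coeff, rule ccontr)
  assume e: "\<not> degree P \<le> e"
  define n where "n = degree P"
  have "(\<lambda>N. poly P (real N) / real N ^ n) \<longlonglongrightarrow> 0"
  proof (rule Lim_null_comparison)
    show "\<forall>\<^sub>F N in sequentially. norm (poly P (real N) / real N ^ n) \<le> C * (1 / real N) ^ (n - e)"
      using eventually_gt_at_top [of 0]
    proof eventually_elim
      case (elim N)
      have "norm (poly P (real N) / real N ^ n) \<le> C * real N ^ e / real N ^ n"
        using assms [of N] elim by (simp add: divide_right_mono)
      also have "\<dots> = C * (1 / real N) ^ (n - e)"
        using elim e by (simp add: n_def power_diff power_divide)
      finally show ?case .
    qed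
    have "(\<lambda>N. C * (1 / real N) ^ (n - e)) \<longlonglongrightarrow> C * 0 ^ (n - e)"
      by (intro tendsto_intros lim_1_over_n)
    then show "(\<lambda>N. C * (1 / real N) ^ (n - e)) \<longlonglongrightarrow> 0"
      using e by (simp only: n_def) (simp add: power_0_left)
  qed
  then have "coeff P n = 0"
    using poly_over_power_tendsto_coeff [of P n] LIMSEQ_unique by (metis n_def order_refl)
  with e show False by (simp add: n_def)
qed

text \<open>
  The coefficient of \<open>N^e\<close> in \<open>N^(2e - L) N (N - 1) \<cdots> (N - K + 1)\<close> is that of \<open>N^(L - e)\<close> in
  the falling factorial, a Stirling number of the first kind that is \<open>0\<close> when \<open>L < e\<close>. Used
  with \<open>e = m\<close> for one coordinate and with \<open>e = md\<close> for the joint moment.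
\<close>

lemma falling_sum_tendsto:
  fixes c :: "'b \<Rightarrow> real" and L K :: "'b \<Rightarrow> nat"
  assumes L: "\<And>a. a \<in> A \<Longrightarrow> L a \<le> 2 * e"
    and f: "\<And>N. f N = (\<Sum>a\<in>A. c a * (real N ^ (2 * e - L a) * falling (real N) (K a)))"
    and bound: "\<exists>C. \<forall>N\<ge>1. \<bar>f N\<bar> \<le> C * real N ^ e"
  shows "(\<lambda>N. f N / real N ^ e) \<longlonglongrightarrow>
    (\<Sum>a\<in>A. c a * real_of_int (signed_stirling (K a) (int (L a) - int e)))"
proof -
  define P where "P = (\<Sum>a\<in>A. smult (c a)
    (monom 1 (2 * e - L a) * map_poly real_of_int (falling_poly (K a))))"
  have P: "poly P (real N) = f N" for N
    by (simp add: P_def f poly_sum poly_monom poly_falling_poly falling_def)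
  obtain C where "\<And>N. N \<ge> 1 \<Longrightarrow> \<bar>poly P (real N)\<bar> \<le> C * real N ^ e"
    using bound P by auto
  then have "(\<lambda>N. f N / real N ^ e) \<longlonglongrightarrow> coeff P e"
    unfolding P [symmetric] by (rule poly_over_power_tendsto_coeff_bounded)
  also have "coeff P e = (\<Sum>a\<in>A. c a * real_of_int (signed_stirling (K a) (int (L a) - int e)))"
    unfolding P_def coeff_sum
  proof (intro sum.cong refl)
    fix a assume "a \<in> A"
    then have "L a \<le> 2 * e" by (rule L)
    then have "coeff (monom 1 (2 * e - L a) * map_poly real_of_int (falling_poly (K a))) e
        = real_of_int (signed_stirling (K a) (int (L a) - int e))"
      by (auto simp: coeff_monom_mult signed_stirling_def coeff_map_poly nat_diff_distrib'
        intro!: arg_cong [where f = "coeff _"])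
    then show "coeff (smult (c a) (monom 1 (2 * e - L a)
        * map_poly real_of_int (falling_poly (K a)))) e
      = c a * real_of_int (signed_stirling (K a) (int (L a) - int e))"
      by simp
  qed
  finally show ?thesis .
qed

section \<open>Limits of the normalised moments\<close>

text \<open>
  The factor contributed by one coordinate to a summand of the expanded moment, apart from the
  dependence on \<open>N\<close>; its exponent combines \<open>q ^ (2m - l)\<close> from the binomial theorem with \<open>q ^ k\<close>
  from the factorial moment.
\<close>

definition expansion_coeff :: "real \<Rightarrow> nat \<Rightarrow> nat \<Rightarrow> nat \<Rightarrow> real" where
  "expansion_coeff q m l k =
    real (Stirling l k) * real (2 * m choose l) * (- 1) ^ l * q ^ (2 * m - l + k)"

lemma even_power_expansion:
  "(x - y * q) ^ (2 * m) = (\<Sum>l\<le>2 * m. \<Sum>k\<le>l. real (Stirling l k) * real (2 * m choose l)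
     * (- 1) ^ l * q ^ (2 * m - l) * y ^ (2 * m - l) * falling x k)"
proof -
  have "(- (y * q)) ^ (2 * m - l) = (- 1) ^ l * q ^ (2 * m - l) * y ^ (2 * m - l)" if "l \<le> 2 * m" for l
  proof -
    have "(- (y * q)) ^ (2 * m - l) = (- 1) ^ (2 * m - l) * (y * q) ^ (2 * m - l)"
      by (rule power_minus)
    moreover have "(- 1 :: real) ^ (2 * m - l) = (- 1) ^ l"
      using that by (simp add: minus_one_power_iff)
    ultimately show ?thesis by (simp add: power_mult_distrib mult_ac)
  qed
  moreover have "x ^ l = (\<Sum>k\<le>l. real (Stirling l k) * falling x k)" for l
    by (simp add: power_eq_sum_Stirling falling_def)
  ultimately show ?thesis
    unfolding diff_conv_add_uminus binomial_ring
    by (intro sum.cong refl) (simp add: sum_distrib_left sum_distrib_right mult_ac)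
qed

lemma central_moment_expansion:
  "central_moment p i (2 * m) N = (\<Sum>(l, k)\<in>(SIGMA l:{..2 * m}. {..l}).
     expansion_coeff (p i) m l k * (real N ^ (2 * m - l) * falling (real N) k))"
  unfolding central_moment_def even_power_expansion multinomial_mean_sum multinomial_mean_cmult
    multinomial_marginal_factorial_moment expansion_coeff_def
  by (subst sum.Sigma) (auto intro!: sum.cong simp: power_add mult_ac)

lemma central_moment_tendsto:
  "(\<lambda>N. central_moment p i (2 * m) N / real N ^ m) \<longlonglongrightarrow>
    (\<Sum>l\<le>2 * m. \<Sum>k\<le>l. expansion_coeff (p i) m l k * real_of_int (signed_stirling k (int l - int m)))"
proof -
  have "(\<lambda>N. central_moment p i (2 * m) N / real N ^ m) \<longlonglongrightarrow>
      (\<Sum>a\<in>(SIGMA l:{..2 * m}. {..l}). expansion_coeff (p i) m (fst a) (snd a)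
        * real_of_int (signed_stirling (snd a) (int (fst a) - int m)))"
    using central_moment_bound_even
    by (intro falling_sum_tendsto) (auto simp: central_moment_expansion case_prod_unfold)
  then show ?thesis by (subst sum.Sigma) (auto simp: case_prod_unfold)
qed

lemma prod_sum_functions:
  fixes f :: "'d::finite \<Rightarrow> nat \<Rightarrow> nat \<Rightarrow> real"
  shows "(\<Prod>i\<in>UNIV. \<Sum>l\<le>n. \<Sum>k\<le>l. f i l k) =
    (\<Sum>l\<in>{l. \<forall>i. l i \<le> n}. \<Sum>k\<in>{k. \<forall>i. k i \<le> l i}. \<Prod>i\<in>UNIV. f i (l i) (k i))"
proof -
  have P: "PiE UNIV (\<lambda>i. {..b i}) = {l. \<forall>i. l i \<le> b i}" for b :: "'d \<Rightarrow> nat"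
    by auto
  show ?thesis
    by (simp add: prod_sum_PiE P)
qed

lemma finite_bounded_functions: "finite {l :: 'd::finite \<Rightarrow> nat. \<forall>i. l i \<le> b i}"
proof -
  have "{l :: 'd \<Rightarrow> nat. \<forall>i. l i \<le> b i} = PiE UNIV (\<lambda>i. {..b i})" by auto
  then show ?thesis by (auto intro: finite_PiE)
qed

lemma joint_moment_expansion:
  fixes p :: "'d::finite \<Rightarrow> real"
  shows "joint_moment p (2 * m) N =
    (\<Sum>(l, k)\<in>(SIGMA l:{l :: 'd \<Rightarrow> nat. \<forall>i. l i \<le> 2 * m}. {k. \<forall>i. k i \<le> l i}).
      (\<Prod>i\<in>UNIV. expansion_coeff (p i) m (l i) (k i))
      * (real N ^ (2 * (m * CARD('d)) - (\<Sum>i\<in>UNIV. l i)) * falling (real N) (\<Sum>i\<in>UNIV. k i)))"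
proof -
  define t where "t i l k = real (Stirling l k) * real (2 * m choose l)
     * (- 1) ^ l * p i ^ (2 * m - l) * real N ^ (2 * m - l)" for i l k
  have "joint_moment p (2 * m) N = (\<Sum>l\<in>{l :: 'd \<Rightarrow> nat. \<forall>i. l i \<le> 2 * m}. \<Sum>k\<in>{k. \<forall>i. k i \<le> l i}.
      (\<Prod>i\<in>UNIV. t i (l i) (k i))
      * (falling (real N) (\<Sum>i\<in>UNIV. k i) * (\<Prod>i\<in>UNIV. p i ^ k i)))"
    unfolding joint_moment_def even_power_expansion prod_sum_functions multinomial_mean_sum
      t_def [symmetric] prod.distrib multinomial_mean_cmult multinomial_factorial_moment ..
  also have "\<dots> = (\<Sum>l\<in>{l :: 'd \<Rightarrow> nat. \<forall>i. l i \<le> 2 * m}. \<Sum>k\<in>{k. \<forall>i. k i \<le> l i}.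
      (\<Prod>i\<in>UNIV. expansion_coeff (p i) m (l i) (k i))
      * (real N ^ (2 * (m * CARD('d)) - (\<Sum>i\<in>UNIV. l i)) * falling (real N) (\<Sum>i\<in>UNIV. k i)))"
  proof (intro sum.cong refl)
    fix l k :: "'d \<Rightarrow> nat"
    assume l: "l \<in> {l. \<forall>i. l i \<le> 2 * m}"
    have "(\<Sum>i\<in>UNIV. 2 * m - l i) = (\<Sum>i\<in>(UNIV :: 'd set). 2 * m) - (\<Sum>i\<in>UNIV. l i)"
      using l by (intro sum_subtractf_nat) auto
    then have "(\<Prod>i\<in>UNIV. real N ^ (2 * m - l i)) = real N ^ (2 * (m * CARD('d)) - (\<Sum>i\<in>UNIV. l i))"
      by (simp add: power_sum [symmetric] mult_ac)
    then show "(\<Prod>i\<in>UNIV. t i (l i) (k i))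
      * (falling (real N) (\<Sum>i\<in>UNIV. k i) * (\<Prod>i\<in>UNIV. p i ^ k i)) =
      (\<Prod>i\<in>UNIV. expansion_coeff (p i) m (l i) (k i))
      * (real N ^ (2 * (m * CARD('d)) - (\<Sum>i\<in>UNIV. l i)) * falling (real N) (\<Sum>i\<in>UNIV. k i))"
      by (simp add: t_def expansion_coeff_def prod.distrib power_add mult_ac)
  qed
  also have "\<dots> = (\<Sum>(l, k)\<in>(SIGMA l:{l :: 'd \<Rightarrow> nat. \<forall>i. l i \<le> 2 * m}. {k. \<forall>i. k i \<le> l i}).
      (\<Prod>i\<in>UNIV. expansion_coeff (p i) m (l i) (k i))
      * (real N ^ (2 * (m * CARD('d)) - (\<Sum>i\<in>UNIV. l i)) * falling (real N) (\<Sum>i\<in>UNIV. k i)))"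
    by (intro sum.Sigma) (auto intro: finite_bounded_functions)
  finally show ?thesis .
qed

lemma joint_moment_tendsto:
  fixes p :: "'d::finite \<Rightarrow> real"
  assumes "p \<in> simplex_interior"
  shows "(\<lambda>N. joint_moment p (2 * m) N / real N ^ (m * CARD('d))) \<longlonglongrightarrow>
    (\<Sum>l\<in>{l :: 'd \<Rightarrow> nat. \<forall>i. l i \<le> 2 * m}. \<Sum>k\<in>{k. \<forall>i. k i \<le> l i}.
      (\<Prod>i\<in>UNIV. expansion_coeff (p i) m (l i) (k i))
      * real_of_int (signed_stirling (\<Sum>i\<in>UNIV. k i) (int (\<Sum>i\<in>UNIV. l i) - int (m * CARD('d)))))"
proof -
  let ?A = "SIGMA l:{l :: 'd \<Rightarrow> nat. \<forall>i. l i \<le> 2 * m}. {k :: 'd \<Rightarrow> nat. \<forall>i. k i \<le> l i}"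
  have "(\<lambda>N. joint_moment p (2 * m) N / real N ^ (m * CARD('d))) \<longlonglongrightarrow>
      (\<Sum>a\<in>?A. (\<Prod>i\<in>UNIV. expansion_coeff (p i) m (fst a i) (snd a i)) * real_of_int
        (signed_stirling (\<Sum>i\<in>UNIV. snd a i) (int (\<Sum>i\<in>UNIV. fst a i) - int (m * CARD('d)))))"
  proof (rule falling_sum_tendsto)
    fix a assume a: "a \<in> ?A"
    have "(\<Sum>i\<in>UNIV. fst a i) \<le> (\<Sum>i\<in>(UNIV :: 'd set). 2 * m)"
      using a by (intro sum_mono) auto
    then show "(\<Sum>i\<in>UNIV. fst a i) \<le> 2 * (m * CARD('d))" by (simp add: mult_ac)
  next
    show "joint_moment p (2 * m) N = (\<Sum>a\<in>?A. (\<Prod>i\<in>UNIV. expansion_coeff (p i) m (fst a i) (snd a i))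
        * (real N ^ (2 * (m * CARD('d)) - (\<Sum>i\<in>UNIV. fst a i))
          * falling (real N) (\<Sum>i\<in>UNIV. snd a i)))" for N
      by (simp add: joint_moment_expansion case_prod_unfold)
  qed (rule joint_moment_bound [OF assms])
  then show ?thesis
    by (subst sum.Sigma) (auto simp: case_prod_unfold finite_bounded_functions)
qed

text \<open>
  Since \<open>sqrt N ^ (2m) = N ^ m\<close> in each coordinate, the difference is that between the
  normalised joint moment and the product of the normalised one-coordinate moments, whose limits are known.
\<close>

theorem theorem1:
  fixes p :: "'d::finite \<Rightarrow> real" and m :: nat
    and M :: "nat \<Rightarrow> 'a measure" and \<xi> :: "nat \<Rightarrow> 'a \<Rightarrow> 'd \<Rightarrow> nat"
  assumes "m \<ge> 1"
    and "p \<in> simplex_interior"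
    and "\<And>N. N \<ge> 1 \<Longrightarrow> multinomial_distributed (M N) (\<xi> N) N p"
  shows "let D = (\<lambda>N.
             (\<integral>\<omega>. (\<Prod>i\<in>UNIV. ((real (\<xi> N \<omega> i) - real N * p i) / sqrt (real N)) ^ (2 * m)) \<partial>M N)
             - (\<Prod>i\<in>UNIV. \<integral>\<omega>. ((real (\<xi> N \<omega> i) - real N * p i) / sqrt (real N)) ^ (2 * m) \<partial>M N))
         in convergent D \<and>
            (lim D \<ge> 0 \<longleftrightarrow>
             (\<Sum>l\<in>{l :: 'd \<Rightarrow> nat. \<forall>i. l i \<le> 2 * m}. \<Sum>k\<in>{k :: 'd \<Rightarrow> nat. \<forall>i. k i \<le> l i}.
                real_of_int
                  (signed_stirling (\<Sum>i\<in>UNIV. k i) (int (\<Sum>i\<in>UNIV. l i) - int (m * CARD('d)))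
                   - (\<Prod>i\<in>UNIV. signed_stirling (k i) (int (l i) - int m)))
                * (\<Prod>i\<in>UNIV. real (Stirling (l i) (k i)) * real (2 * m choose l i)
                     * (- 1) ^ l i * p i ^ (2 * m - l i + k i))) \<ge> 0)"
proof -
  define D where "D = (\<lambda>N.
     (\<integral>\<omega>. (\<Prod>i\<in>UNIV. ((real (\<xi> N \<omega> i) - real N * p i) / sqrt (real N)) ^ (2 * m)) \<partial>M N)
     - (\<Prod>i\<in>UNIV. \<integral>\<omega>. ((real (\<xi> N \<omega> i) - real N * p i) / sqrt (real N)) ^ (2 * m) \<partial>M N))"
  let ?J = "\<lambda>N. joint_moment p (2 * m) N / real N ^ (m * CARD('d))"
  let ?P = "\<lambda>N. \<Prod>i\<in>UNIV. central_moment p i (2 * m) N / real N ^ m"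
  let ?L = "\<Sum>l\<in>{l :: 'd \<Rightarrow> nat. \<forall>i. l i \<le> 2 * m}. \<Sum>k\<in>{k :: 'd \<Rightarrow> nat. \<forall>i. k i \<le> l i}.
      real_of_int (signed_stirling (\<Sum>i\<in>UNIV. k i) (int (\<Sum>i\<in>UNIV. l i) - int (m * CARD('d)))
        - (\<Prod>i\<in>UNIV. signed_stirling (k i) (int (l i) - int m)))
      * (\<Prod>i\<in>UNIV. expansion_coeff (p i) m (l i) (k i))"
  have D: "D N = ?J N - ?P N" if "N \<ge> 1" for N
  proof -
    note int = integral_multinomial [OF assms(2) assms(3) [OF that]]
    have scale: "(x / sqrt (real N)) ^ (2 * m) = (1 / real N ^ m) * x ^ (2 * m)" for x
      by (simp add: power_divide power_mult)
    have "(\<Prod>i\<in>(UNIV :: 'd set). 1 / real N ^ m) = 1 / real N ^ (m * CARD('d))"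
      by (simp add: power_mult power_one_over)
    then have "(\<integral>\<omega>. (\<Prod>i\<in>UNIV. ((real (\<xi> N \<omega> i) - real N * p i) / sqrt (real N)) ^ (2 * m)) \<partial>M N)
        = ?J N"
      using int [of "\<lambda>k. \<Prod>i\<in>UNIV. ((real (k i) - real N * p i) / sqrt (real N)) ^ (2 * m)"]
      by (simp only: scale prod.distrib multinomial_mean_cmult joint_moment_def) simp
    moreover have "(\<integral>\<omega>. ((real (\<xi> N \<omega> i) - real N * p i) / sqrt (real N)) ^ (2 * m) \<partial>M N)
        = central_moment p i (2 * m) N / real N ^ m" for i
      using int [of "\<lambda>k. ((real (k i) - real N * p i) / sqrt (real N)) ^ (2 * m)"]
      by (simp only: scale multinomial_mean_cmult central_moment_def) simp
    ultimately show ?thesis by (simp add: D_def)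
  qed
  have P: "?P \<longlonglongrightarrow> (\<Prod>i\<in>UNIV. \<Sum>l\<le>2 * m. \<Sum>k\<le>l.
      expansion_coeff (p i) m l k * real_of_int (signed_stirling k (int l - int m)))"
    by (intro tendsto_prod central_moment_tendsto)
  have "(\<lambda>N. ?J N - ?P N) \<longlonglongrightarrow> ?L"
    using tendsto_diff [OF joint_moment_tendsto [OF assms(2), of m] P]
    by (simp add: prod_sum_functions prod.distrib sum_subtractf [symmetric] algebra_simps)
  moreover have "\<forall>\<^sub>F N in sequentially. ?J N - ?P N = D N"
    using eventually_ge_at_top [of 1] by eventually_elim (simp add: D)
  ultimately have "D \<longlonglongrightarrow> ?L" by (rule Lim_transform_eventually)
  then have "convergent D" "lim D = ?L"
    by (auto simp: convergent_def dest: limI)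
  then show ?thesis
    unfolding Let_def D_def [symmetric] by (simp add: expansion_coeff_def)
qed

end
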